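(* Let $(M^{2n+1},\phi,\xi,\eta,g)$ be an almost $\alpha$-paracosymplectic manifold with $n\geq2$, let $U=\{p\in M:\alpha(p)\neq0\}$ and let $\gamma$ be a positive constant. Then on $U$ the manifold is locally $D_{\gamma,\alpha}$-homothetic to an almost para-Kenmotsu manifold; i.e., near every point of $U$ the $D_{\gamma,\beta}$-homothetic deformation of $(\phi,\xi,\eta,g)$ with $\beta=\alpha$ is an almost para-Kenmotsu structure.
   Context: An almost paracontact metric manifold is a smooth manifold $M$ of dimension $2n+1$ with a $(1,1)$-tensor field $\phi$, a vector field $\xi$, a 1-form $\eta$ and a pseudo-Riemannian metric $g$ of signature $(n+1,n)$ such that $\eta(\xi)=1$, $\phi^2=\mathrm{Id}-\eta\otimes\xi$, the eigendistributions of $\phi|_{\ker\eta}$ for the eigenvalues $+1$ and $-1$ both have rank $n$, and $g(\phi X,\phi Y)=-g(X,Y)+\eta(X)\eta(Y)$ (hence $\eta(X)=g(X,\xi)$, $\phi\xi=0$, $\eta\circ\phi=0$). Its fundamental 2-form is $\Phi(X,Y)=g(\phi X,Y)$. It is almost $\alpha$-paracosymplectic, where $\alpha$ is a smooth real function on $M$ (possibly constant), if $d\eta=0$ and $d\Phi=2\alpha\,\eta\wedge\Phi$ (with $d$ and $\wedge$ normalized compatibly, so that the cyclic sum of $(\nabla_X\Phi)(Y,Z)$ equals $2\alpha$ times the cyclic sum of $\eta(X)\Phi(Y,Z)$). It is almost para-Kenmotsu if this holds with $\alpha=1$ constant. For a positive constant $\gamma$ and a smooth nowhere-zero function $\beta$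 with $d\beta\wedge\eta=0$, the $D_{\gamma,\beta}$-homothetic deformation of $(\phi,\xi,\eta,g)$ is the almost paracontact metric structure $\tilde\phi=\phi$, $\tilde\xi=\frac1\beta\xi$, $\tilde\eta=\beta\eta$, $\tilde g=\gamma g+(\beta^2-\gamma)\eta\otimes\eta$. *)

theory Defs
  imports "HOL-Analysis.Analysis"
begin

section \<open>Smooth manifolds\<close>

text \<open>Intended for open \<^term>\<open>S\<close>: \<^term>\<open>Ck_on k S f\<close> says that \<^term>\<open>f\<close> is of class \<open>C\<^sup>k\<close> on \<^term>\<open>S\<close>.\<close>

primrec Ck_on :: "nat \<Rightarrow> 'e::euclidean_space set \<Rightarrow> ('e \<Rightarrow> 'b::real_normed_vector) \<Rightarrow> bool" where
  "Ck_on 0 S f \<longleftrightarrow> continuous_on S f"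
| "Ck_on (Suc k) S f \<longleftrightarrow>
     (\<forall>x\<in>S. f differentiable (at x)) \<and>
     (\<forall>v. Ck_on k S (\<lambda>x. frechet_derivative f (at x) v))"

definition smooth_on :: "'e::euclidean_space set \<Rightarrow> ('e \<Rightarrow> 'b::real_normed_vector) \<Rightarrow> bool" where
  "smooth_on S f \<longleftrightarrow> (\<forall>k. Ck_on k S f)"

text \<open>A chart is a pair of a domain and a map; the values of the map off the domain are irrelevant.\<close>

type_synonym ('a, 'e) chart = "'a set \<times> ('a \<Rightarrow> 'e)"

definition chart_inv :: "('a, 'e) chart \<Rightarrow> 'e \<Rightarrow> 'a" where
  "chart_inv c = inv_into (fst c) (snd c)"

definition is_chart :: "'a topology \<Rightarrow> ('a, 'e::euclidean_space) chart \<Rightarrow> bool" where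
  "is_chart X c \<longleftrightarrow>
     openin X (fst c) \<and> open (snd c ` fst c) \<and>
     homeomorphic_map (subtopology X (fst c)) (top_of_set (snd c ` fst c)) (snd c)"

definition transition :: "('a, 'e) chart \<Rightarrow> ('a, 'e) chart \<Rightarrow> 'e \<Rightarrow> 'e" where
  "transition c d = snd d \<circ> chart_inv c"

definition smooth_atlas :: "'a topology \<Rightarrow> ('a, 'e::euclidean_space) chart set \<Rightarrow> bool" where
  "smooth_atlas X A \<longleftrightarrow>
     (\<forall>c\<in>A. is_chart X c) \<and> (\<Union>c\<in>A. fst c) = topspace X \<and>
     (\<forall>c\<in>A. \<forall>d\<in>A. smooth_on (snd c ` (fst c \<inter> fst d)) (transition c d))"

text \<open>The atlas need not be maximal. The dimension is that of the model space \<^typ>\<open>'e\<close>.\<close>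

definition smooth_manifold :: "'a topology \<Rightarrow> ('a, 'e::euclidean_space) chart set \<Rightarrow> bool" where
  "smooth_manifold X A \<longleftrightarrow> Hausdorff_space X \<and> second_countable X \<and> smooth_atlas X A"


section \<open>Tensor fields\<close>

text \<open>
  The tangent space at a point \<open>p\<close> is \<^typ>\<open>'e\<close> as seen through any chart \<open>c\<close> at \<open>p\<close>; the
  identifications belonging to two charts \<open>c\<close>, \<open>d\<close> differ by the differential of the transition
  map, \<open>jac c d p\<close>. A tensor field is accordingly a family of local representatives, indexed by
  the charts of the atlas, that are smooth and transform into each other under \<^term>\<open>jac\<close>.
  Local representatives take a point of the manifold (rather than its coordinates) as argument.

  All notions are relative to an open subset \<^term>\<open>W\<close>, regarded as an open submanifold with the
  tangent spaces of the ambient manifold.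
\<close>

definition jac :: "('a, 'e::euclidean_space) chart \<Rightarrow> ('a, 'e) chart \<Rightarrow> 'a \<Rightarrow> 'e \<Rightarrow> 'e" where
  "jac c d p = frechet_derivative (transition c d) (at (snd c p))"

definition smooth_in_chart ::
    "('a, 'e::euclidean_space) chart \<Rightarrow> 'a set \<Rightarrow> ('a \<Rightarrow> 'b::real_normed_vector) \<Rightarrow> bool" where
  "smooth_in_chart c W f \<longleftrightarrow> smooth_on (snd c ` (fst c \<inter> W)) (f \<circ> chart_inv c)"

type_synonym ('a, 'e) vfield = "('a, 'e) chart \<Rightarrow> 'a \<Rightarrow> 'e"
type_synonym ('a, 'e) endofield = "('a, 'e) chart \<Rightarrow> 'a \<Rightarrow> 'e \<Rightarrow> 'e"
type_synonym ('a, 'e) form1 = "('a, 'e) chart \<Rightarrow> 'a \<Rightarrow> 'e \<Rightarrow> real"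
type_synonym ('a, 'e) form2 = "('a, 'e) chart \<Rightarrow> 'a \<Rightarrow> 'e \<Rightarrow> 'e \<Rightarrow> real"
type_synonym ('a, 'e) form3 = "('a, 'e) chart \<Rightarrow> 'a \<Rightarrow> 'e \<Rightarrow> 'e \<Rightarrow> 'e \<Rightarrow> real"

definition smooth_function ::
    "('a, 'e::euclidean_space) chart set \<Rightarrow> 'a set \<Rightarrow> ('a \<Rightarrow> real) \<Rightarrow> bool" where
  "smooth_function A W f \<longleftrightarrow> (\<forall>c\<in>A. smooth_in_chart c W f)"

definition vector_field ::
    "('a, 'e::euclidean_space) chart set \<Rightarrow> 'a set \<Rightarrow> ('a, 'e) vfield \<Rightarrow> bool" where
  "vector_field A W Z \<longleftrightarrow>
     (\<forall>c\<in>A. smooth_in_chart c W (Z c)) \<and>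
     (\<forall>c\<in>A. \<forall>d\<in>A. \<forall>p \<in> fst c \<inter> fst d \<inter> W. Z d p = jac c d p (Z c p))"

definition one_form ::
    "('a, 'e::euclidean_space) chart set \<Rightarrow> 'a set \<Rightarrow> ('a, 'e) form1 \<Rightarrow> bool" where
  "one_form A W \<omega> \<longleftrightarrow>
     (\<forall>c\<in>A. \<forall>p \<in> fst c \<inter> W. linear (\<omega> c p)) \<and>
     (\<forall>c\<in>A. \<forall>u. smooth_in_chart c W (\<lambda>p. \<omega> c p u)) \<and>
     (\<forall>c\<in>A. \<forall>d\<in>A. \<forall>p \<in> fst c \<inter> fst d \<inter> W. \<forall>u. \<omega> d p (jac c d p u) = \<omega> c p u)"

definition endo_field ::
    "('a, 'e::euclidean_space) chart set \<Rightarrow> 'a set \<Rightarrow> ('a, 'e) endofield \<Rightarrow> bool" where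
  "endo_field A W F \<longleftrightarrow>
     (\<forall>c\<in>A. \<forall>p \<in> fst c \<inter> W. linear (F c p)) \<and>
     (\<forall>c\<in>A. \<forall>u. smooth_in_chart c W (\<lambda>p. F c p u)) \<and>
     (\<forall>c\<in>A. \<forall>d\<in>A. \<forall>p \<in> fst c \<inter> fst d \<inter> W. \<forall>u.
        F d p (jac c d p u) = jac c d p (F c p u))"

definition bilinear_field ::
    "('a, 'e::euclidean_space) chart set \<Rightarrow> 'a set \<Rightarrow> ('a, 'e) form2 \<Rightarrow> bool" where
  "bilinear_field A W B \<longleftrightarrow>
     (\<forall>c\<in>A. \<forall>p \<in> fst c \<inter> W. bilinear (B c p)) \<and>
     (\<forall>c\<in>A. \<forall>u v. smooth_in_chart c W (\<lambda>p. B c p u v)) \<and>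
     (\<forall>c\<in>A. \<forall>d\<in>A. \<forall>p \<in> fst c \<inter> fst d \<inter> W. \<forall>u v.
        B d p (jac c d p u) (jac c d p v) = B c p u v)"

text \<open>Sylvester's form: an orthonormal basis with \<^term>\<open>a\<close> vectors of square \<open>1\<close> and \<^term>\<open>b\<close> of square \<open>-1\<close>.\<close>

definition has_signature :: "('e::euclidean_space \<Rightarrow> 'e \<Rightarrow> real) \<Rightarrow> nat \<Rightarrow> nat \<Rightarrow> bool" where
  "has_signature B a b \<longleftrightarrow>
     (\<exists>P N. independent (P \<union> N) \<and> span (P \<union> N) = UNIV \<and> card P = a \<and> card N = b \<and>
        (\<forall>u\<in>P. B u u = 1) \<and> (\<forall>u\<in>N. B u u = - 1) \<and>
        (\<forall>u \<in> P \<union> N. \<forall>v \<in> P \<union> N. u \<noteq> v \<longrightarrow> B u v = 0))"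

definition pseudo_riemannian_metric ::
    "('a, 'e::euclidean_space) chart set \<Rightarrow> 'a set \<Rightarrow> nat \<Rightarrow> nat \<Rightarrow> ('a, 'e) form2 \<Rightarrow> bool" where
  "pseudo_riemannian_metric A W a b g \<longleftrightarrow>
     bilinear_field A W g \<and>
     (\<forall>c\<in>A. \<forall>p \<in> fst c \<inter> W. (\<forall>u v. g c p u v = g c p v u) \<and> has_signature (g c p) a b)"


section \<open>Exterior calculus\<close>

definition chart_deriv ::
    "('a, 'e::euclidean_space) chart \<Rightarrow> ('a \<Rightarrow> real) \<Rightarrow> 'a \<Rightarrow> 'e \<Rightarrow> real" where
  "chart_deriv c f p u = frechet_derivative (f \<circ> chart_inv c) (at (snd c p)) u"

text \<open>
  Exterior derivatives are given by the coordinate expression of the invariant formula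
  \<open>d\<omega>(X,Y) = X \<omega>(Y) - Y \<omega>(X) - \<omega>([X,Y])\<close> and its analogue for 2-forms, evaluated on
  coordinate-constant vector fields, whose brackets vanish. There are no factors \<open>1/2\<close>, \<open>1/3\<close>;
  so for a torsion-free connection \<open>d\<Phi>(X,Y,Z)\<close> is the cyclic sum of
  \<open>(\<nabla>\<^sub>X \<Phi>)(Y,Z)\<close>. The wedge product is normalized to match.
\<close>

definition d0 :: "('a \<Rightarrow> real) \<Rightarrow> ('a, 'e::euclidean_space) form1" where
  "d0 f c p u = chart_deriv c f p u"

definition d1 :: "('a, 'e::euclidean_space) form1 \<Rightarrow> ('a, 'e) form2" where
  "d1 \<omega> c p u v = chart_deriv c (\<lambda>q. \<omega> c q v) p u - chart_deriv c (\<lambda>q. \<omega> c q u) p v"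

definition d2 :: "('a, 'e::euclidean_space) form2 \<Rightarrow> ('a, 'e) form3" where
  "d2 \<Omega> c p u v w =
     chart_deriv c (\<lambda>q. \<Omega> c q v w) p u + chart_deriv c (\<lambda>q. \<Omega> c q w u) p v +
     chart_deriv c (\<lambda>q. \<Omega> c q u v) p w"

definition wedge11 :: "('a, 'e) form1 \<Rightarrow> ('a, 'e) form1 \<Rightarrow> ('a, 'e) form2" where
  "wedge11 \<omega> \<theta> c p u v = \<omega> c p u * \<theta> c p v - \<omega> c p v * \<theta> c p u"

definition wedge12 :: "('a, 'e) form1 \<Rightarrow> ('a, 'e) form2 \<Rightarrow> ('a, 'e) form3" where
  "wedge12 \<omega> \<Omega> c p u v w =
     \<omega> c p u * \<Omega> c p v w + \<omega> c p v * \<Omega> c p w u + \<omega> c p w * \<Omega> c p u v"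


section \<open>Almost paracontact metric structures\<close>

record ('a, 'e) apm_structure =
  phi :: "('a, 'e) endofield"
  xi :: "('a, 'e) vfield"
  eta :: "('a, 'e) form1"
  metric :: "('a, 'e) form2"

definition almost_paracontact_metric_on ::
    "'a topology \<Rightarrow> ('a, 'e::euclidean_space) chart set \<Rightarrow> nat \<Rightarrow> 'a set \<Rightarrow>
     ('a, 'e) apm_structure \<Rightarrow> bool" where
  "almost_paracontact_metric_on X A n W S \<longleftrightarrow>
     smooth_manifold X A \<and> DIM('e) = 2 * n + 1 \<and> openin X W \<and>
     endo_field A W (phi S) \<and> vector_field A W (xi S) \<and> one_form A W (eta S) \<and>
     pseudo_riemannian_metric A W (n + 1) n (metric S) \<and>
     (\<forall>c\<in>A. \<forall>p \<in> fst c \<inter> W.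
        eta S c p (xi S c p) = 1 \<and>
        (\<forall>u. phi S c p (phi S c p u) = u - eta S c p u *\<^sub>R xi S c p) \<and>
        dim {u. eta S c p u = 0 \<and> phi S c p u = u} = n \<and>
        dim {u. eta S c p u = 0 \<and> phi S c p u = - u} = n \<and>
        (\<forall>u v. metric S c p (phi S c p u) (phi S c p v) =
                 - metric S c p u v + eta S c p u * eta S c p v))"

definition fundamental_form :: "('a, 'e) apm_structure \<Rightarrow> ('a, 'e) form2" where
  "fundamental_form S c p u v = metric S c p (phi S c p u) v"

definition almost_paracosymplectic_on ::
    "'a topology \<Rightarrow> ('a, 'e::euclidean_space) chart set \<Rightarrow> nat \<Rightarrow> 'a set \<Rightarrow> ('a \<Rightarrow> real) \<Rightarrow>
     ('a, 'e) apm_structure \<Rightarrow> bool" where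
  "almost_paracosymplectic_on X A n W \<alpha> S \<longleftrightarrow>
     almost_paracontact_metric_on X A n W S \<and> smooth_function A W \<alpha> \<and>
     (\<forall>c\<in>A. \<forall>p \<in> fst c \<inter> W.
        (\<forall>u v. d1 (eta S) c p u v = 0) \<and>
        (\<forall>u v w. d2 (fundamental_form S) c p u v w =
                   2 * \<alpha> p * wedge12 (eta S) (fundamental_form S) c p u v w))"

definition almost_para_kenmotsu_on ::
    "'a topology \<Rightarrow> ('a, 'e::euclidean_space) chart set \<Rightarrow> nat \<Rightarrow> 'a set \<Rightarrow>
     ('a, 'e) apm_structure \<Rightarrow> bool" where
  "almost_para_kenmotsu_on X A n W S \<longleftrightarrow> almost_paracosymplectic_on X A n W (\<lambda>p. 1) S"

text \<open>The conditions on the parameters under which the deformation is defined on \<^term>\<open>W\<close>.\<close>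

definition D_admissible_on ::
    "('a, 'e::euclidean_space) chart set \<Rightarrow> 'a set \<Rightarrow> real \<Rightarrow> ('a \<Rightarrow> real) \<Rightarrow>
     ('a, 'e) apm_structure \<Rightarrow> bool" where
  "D_admissible_on A W \<gamma> \<beta> S \<longleftrightarrow>
     \<gamma> > 0 \<and> smooth_function A W \<beta> \<and> (\<forall>p\<in>W. \<beta> p \<noteq> 0) \<and>
     (\<forall>c\<in>A. \<forall>p \<in> fst c \<inter> W. \<forall>u v. wedge11 (d0 \<beta>) (eta S) c p u v = 0)"

definition D_deformation ::
    "real \<Rightarrow> ('a \<Rightarrow> real) \<Rightarrow> ('a, 'e::euclidean_space) apm_structure \<Rightarrow> ('a, 'e) apm_structure" where
  "D_deformation \<gamma> \<beta> S =
     \<lparr> phi = phi S,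
       xi = (\<lambda>c p. (1 / \<beta> p) *\<^sub>R xi S c p),
       eta = (\<lambda>c p u. \<beta> p * eta S c p u),
       metric = (\<lambda>c p u v. \<gamma> * metric S c p u v +
                  ((\<beta> p)\<^sup>2 - \<gamma>) * eta S c p u * eta S c p v) \<rparr>"

end

theory Submission
  imports Defs
begin

text \<open>
  Write \<open>\<Phi>\<close> for the fundamental form. A deformation by \<open>\<beta>\<close> turns \<open>d\<Phi> = 2\<alpha> \<eta> \<and> \<Phi>\<close> into the same equation
  with \<open>\<alpha>/\<beta>\<close> in place of \<open>\<alpha>\<close>, because it only rescales \<open>\<Phi>\<close> by a constant and \<open>\<eta>\<close> by \<open>\<beta>\<close>
  (\<open>almost_paracosymplectic_on_D_deformation\<close>). Where \<open>\<alpha>\<close> has no zeros, \<open>\<beta> = \<alpha>\<close> gives the factor \<open>1\<close> of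
  an almost para-Kenmotsu structure. What has to be shown is that this choice is admissible, that is,
  \<open>d\<alpha> \<and> \<eta> = 0\<close> (\<open>d_alpha_wedge_eta\<close>).

  Differentiating \<open>d\<Phi> = 2\<alpha> \<eta> \<and> \<Phi>\<close> once more and using \<open>d\<eta> = 0\<close> yields \<open>d\<alpha> \<and> \<eta> \<and> \<Phi> = 0\<close>. This is done in
  coordinates (\<open>da_wedge_e_wedge_F_eq_0\<close>) and rests on the symmetry of second derivatives
  (\<open>dir_deriv_commute\<close>). From there on the question is one of linear algebra in a single tangent
  space: \<open>\<Phi>\<close> is nondegenerate on the \<open>2n\<close>-dimensional kernel of \<open>\<eta>\<close>, and for \<open>n \<ge> 2\<close> a 1-form on that
  space whose wedge product with \<open>\<Phi>\<close> vanishes is zero (\<open>wedge_fundamental_form_cancel\<close>).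

  The deformed tensors again form an almost paracontact metric structure; the point that takes an
  argument is the signature of the deformed metric (\<open>signature_deformed\<close>).
\<close>


section \<open>Smooth functions on open sets\<close>

lemma frechet_derivative_eqI:
  "(f has_derivative f') (at x) \<Longrightarrow> frechet_derivative f (at x) = f'"
  by (rule frechet_derivative_at[symmetric])

lemma Ck_on_subset: "Ck_on k T f \<Longrightarrow> S \<subseteq> T \<Longrightarrow> Ck_on k S f"
  by (induction k arbitrary: f) (auto intro: continuous_on_subset)

text \<open>
  The set has to be open: \<^const>\<open>Ck_on\<close> differentiates with respect to full neighbourhoods, so that
  agreement of two functions on an arbitrary set does not determine their derivatives on it. This is
  also why the product and quotient rules below need open sets.
\<close>

lemma Ck_on_cong:
  assumes "open S" "\<And>x. x \<in> S \<Longrightarrow> f x = g x" "Ck_on k S f"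
  shows "Ck_on k S g"
  using assms(2,3)
proof (induction k arbitrary: f g)
  case 0
  then show ?case by (simp cong: continuous_on_cong)
next
  case (Suc k)
  have diff: "g differentiable (at x)" if "x \<in> S" for x
    using has_derivative_transform_within_open[of f _ x UNIV S g] assms(1) Suc.prems that
    unfolding differentiable_def by (metis Ck_on.simps(2) differentiable_def)
  have "frechet_derivative f (at x) v = frechet_derivative g (at x) v" if "x \<in> S" for x v
    using frechet_derivative_transform_within_open[OF _ assms(1) that Suc.prems(1)] Suc.prems(2) that
    by auto
  from Suc.IH[OF this] diff show ?case using Suc.prems(2) by simp
qed

lemma Ck_on_SucD: "Ck_on (Suc k) S f \<Longrightarrow> Ck_on k S f"
proof (induction k arbitrary: f)
  case 0
  then show ?case
    by (auto intro!: continuous_at_imp_continuous_on differentiable_imp_continuous_within)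
next
  case (Suc k)
  from Suc.prems have "f differentiable (at x)" if "x \<in> S" for x using that by simp
  moreover have "Ck_on k S (\<lambda>x. frechet_derivative f (at x) v)" for v
    using Suc.IH Suc.prems Ck_on.simps(2) by blast
  ultimately show ?case by simp
qed

lemma Ck_on_const: "Ck_on k S (\<lambda>_. c)"
  by (induction k arbitrary: c) auto

lemma Ck_on_add:
  assumes "open S" "Ck_on k S f" "Ck_on k S g"
  shows "Ck_on k S (\<lambda>x. f x + g x)"
  using assms(2,3)
proof (induction k arbitrary: f g)
  case 0
  then show ?case by (simp add: continuous_on_add)
next
  case (Suc k)
  have "Ck_on k S (\<lambda>x. frechet_derivative (\<lambda>x. f x + g x) (at x) v)" for v
  proof (rule Ck_on_cong[OF assms(1)])
    show "Ck_on k S (\<lambda>x. frechet_derivative f (at x) v + frechet_derivative g (at x) v)"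
      using Suc by simp
    fix x assume "x \<in> S"
    with Suc.prems have "(f has_derivative frechet_derivative f (at x)) (at x)"
      "(g has_derivative frechet_derivative g (at x)) (at x)"
      by (simp_all flip: frechet_derivative_works)
    from has_derivative_add[OF this]
    show "frechet_derivative f (at x) v + frechet_derivative g (at x) v =
      frechet_derivative (\<lambda>x. f x + g x) (at x) v"
      by (simp add: frechet_derivative_eqI)
  qed
  then show ?case using Suc.prems by simp
qed

lemma (in bounded_bilinear) Ck_on:
  assumes "open S" "Ck_on k S f" "Ck_on k S g"
  shows "Ck_on k S (\<lambda>x. prod (f x) (g x))"
  using assms(2,3)
proof (induction k arbitrary: f g)
  case 0
  then show ?case by (simp add: continuous_on)
next
  case (Suc k)
  have der: "((\<lambda>x. prod (f x) (g x)) has_derivative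
      (\<lambda>v. prod (f x) (frechet_derivative g (at x) v) + prod (frechet_derivative f (at x) v) (g x))) (at x)"
    if "x \<in> S" for x
    using Suc.prems that by (intro FDERIV) (simp_all flip: frechet_derivative_works)
  have "Ck_on k S (\<lambda>x. frechet_derivative (\<lambda>x. prod (f x) (g x)) (at x) v)" for v
  proof (rule Ck_on_cong[OF assms(1)])
    show "Ck_on k S (\<lambda>x. prod (f x) (frechet_derivative g (at x) v) + prod (frechet_derivative f (at x) v) (g x))"
      using Suc.prems Suc.prems[THEN Ck_on_SucD] by (intro Ck_on_add[OF assms(1)] Suc.IH) auto
  qed (simp add: frechet_derivative_eqI[OF der])
  moreover have "(\<lambda>x. prod (f x) (g x)) differentiable (at x)" if "x \<in> S" for x
    using der[OF that] by (rule differentiableI)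
  ultimately show ?case by simp
qed

text \<open>
  The derivative of \<open>1/f\<close> contains \<open>1/f\<close> again, but of this factor only one order of differentiability
  less is needed, which the induction hypothesis supplies.
\<close>

lemma Ck_on_inverse:
  fixes f :: "'e::euclidean_space \<Rightarrow> real"
  assumes "open S" "Ck_on k S f" "\<And>x. x \<in> S \<Longrightarrow> f x \<noteq> 0"
  shows "Ck_on k S (\<lambda>x. inverse (f x))"
  using assms(2)
proof (induction k)
  case 0
  then show ?case using assms(3) by (auto intro: continuous_on_inverse)
next
  case (Suc k)
  have der: "((\<lambda>x. inverse (f x)) has_derivative
      (\<lambda>v. - (inverse (f x) * frechet_derivative f (at x) v * inverse (f x)))) (at x)"
    if "x \<in> S" for x
    using Suc.prems that assms(3) by (intro Deriv.has_derivative_inverse) (simp_all flip: frechet_derivative_works)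
  have inv: "Ck_on k S (\<lambda>x. inverse (f x))" using Suc Ck_on_SucD by blast
  have "Ck_on k S (\<lambda>x. frechet_derivative (\<lambda>x. inverse (f x)) (at x) v)" for v
  proof (rule Ck_on_cong[OF assms(1)])
    show "Ck_on k S (\<lambda>x. (-1) * (inverse (f x) * frechet_derivative f (at x) v * inverse (f x)))"
      using Suc.prems inv
      by (intro bounded_bilinear.Ck_on[OF bounded_bilinear_mult assms(1)] Ck_on_const) auto
  qed (simp add: frechet_derivative_eqI[OF der])
  moreover have "(\<lambda>x. inverse (f x)) differentiable (at x)" if "x \<in> S" for x
    using der[OF that] by (rule differentiableI)
  ultimately show ?case by simp
qed

lemma smooth_on_const: "smooth_on S (\<lambda>_. c)"
  by (simp add: smooth_on_def Ck_on_const)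

lemma smooth_on_subset: "smooth_on T f \<Longrightarrow> S \<subseteq> T \<Longrightarrow> smooth_on S f"
  using Ck_on_subset unfolding smooth_on_def by blast

lemma smooth_on_cong:
  "open S \<Longrightarrow> (\<And>x. x \<in> S \<Longrightarrow> f x = g x) \<Longrightarrow> smooth_on S f \<Longrightarrow> smooth_on S g"
  using Ck_on_cong unfolding smooth_on_def by blast

lemma smooth_on_add:
  "open S \<Longrightarrow> smooth_on S f \<Longrightarrow> smooth_on S g \<Longrightarrow> smooth_on S (\<lambda>x. f x + g x)"
  using Ck_on_add unfolding smooth_on_def by blast

lemma (in bounded_bilinear) smooth_on:
  "open S \<Longrightarrow> smooth_on S f \<Longrightarrow> smooth_on S g \<Longrightarrow> smooth_on S (\<lambda>x. prod (f x) (g x))"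
  using Ck_on unfolding smooth_on_def by blast

lemmas smooth_on_mult = bounded_bilinear.smooth_on[OF bounded_bilinear_mult]
lemmas smooth_on_scaleR = bounded_bilinear.smooth_on[OF bounded_bilinear_scaleR]
lemmas smooth_on_inner = bounded_bilinear.smooth_on[OF bounded_bilinear_inner]

lemma smooth_on_sum:
  assumes "open S" "\<And>i. i \<in> I \<Longrightarrow> smooth_on S (f i)"
  shows "smooth_on S (\<lambda>x. \<Sum>i\<in>I. f i x)"
  using assms(2)
  by (induction I rule: infinite_finite_induct) (auto intro: smooth_on_const smooth_on_add[OF assms(1)])

lemma smooth_on_inverse:
  fixes f :: "'e::euclidean_space \<Rightarrow> real"
  shows "open S \<Longrightarrow> smooth_on S f \<Longrightarrow> (\<And>x. x \<in> S \<Longrightarrow> f x \<noteq> 0) \<Longrightarrow> smooth_on S (\<lambda>x. inverse (f x))"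
  using Ck_on_inverse unfolding smooth_on_def by blast

lemma smooth_on_continuous: "smooth_on S f \<Longrightarrow> continuous_on S f"
  unfolding smooth_on_def by (metis Ck_on.simps(1))

lemma smooth_on_has_derivative:
  "smooth_on S f \<Longrightarrow> x \<in> S \<Longrightarrow> (f has_derivative frechet_derivative f (at x)) (at x)"
  unfolding smooth_on_def by (metis Ck_on.simps(2) frechet_derivative_works)

lemma smooth_on_frechet_derivative:
  "smooth_on S f \<Longrightarrow> smooth_on S (\<lambda>x. frechet_derivative f (at x) v)"
  unfolding smooth_on_def by (metis Ck_on.simps(2))


section \<open>Symmetry of second derivatives\<close>

abbreviation dir_deriv :: "('e::euclidean_space \<Rightarrow> real) \<Rightarrow> 'e \<Rightarrow> 'e \<Rightarrow> real" where
  "dir_deriv f u x \<equiv> frechet_derivative f (at x) u"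

lemma has_field_derivative_along_line:
  fixes f :: "'e::euclidean_space \<Rightarrow> real"
  assumes "smooth_on S f" "a + s *\<^sub>R u \<in> S"
  shows "((\<lambda>s. f (a + s *\<^sub>R u)) has_field_derivative dir_deriv f u (a + s *\<^sub>R u)) (at s)"
proof -
  let ?D = "frechet_derivative f (at (a + s *\<^sub>R u))"
  have f: "(f has_derivative ?D) (at (a + s *\<^sub>R u))"
    using smooth_on_has_derivative[OF assms] .
  have "((\<lambda>s. a + s *\<^sub>R u) has_derivative (\<lambda>h. h *\<^sub>R u)) (at s)"
    by (auto intro!: derivative_eq_intros)
  from has_derivative_compose[OF this f]
  have "((\<lambda>s. f (a + s *\<^sub>R u)) has_derivative (\<lambda>h. ?D (h *\<^sub>R u))) (at s)" .
  moreover have "?D (h *\<^sub>R u) = ?D u * h" for h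
    using has_derivative_linear[OF f] by (simp add: linear_cmul)
  ultimately show ?thesis unfolding has_field_derivative_def by simp
qed

text \<open>
  Two applications of the mean value theorem to the second difference of \<open>f\<close> over a small
  parallelogram: first along \<open>u\<close>, applied to the increment of \<open>f\<close> in direction \<open>v\<close>, then along \<open>v\<close>.
\<close>

lemma second_difference_mean_value:
  fixes f :: "'e::euclidean_space \<Rightarrow> real"
  assumes f: "smooth_on (ball x r) f" and h: "h > 0" "h * (norm u + norm v) < r"
  shows "\<exists>y \<in> ball x r. f (x + h *\<^sub>R u + h *\<^sub>R v) - f (x + h *\<^sub>R u) - f (x + h *\<^sub>R v) + f x =
           h * h * dir_deriv (dir_deriv f u) v y"
proof -
  have inb: "x + s *\<^sub>R u + t *\<^sub>R v \<in> ball x r" if "0 \<le> s" "s \<le> h" "0 \<le> t" "t \<le> h" for s t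
  proof -
    have "norm (s *\<^sub>R u + t *\<^sub>R v) \<le> s * norm u + t * norm v"
      using norm_triangle_ineq[of "s *\<^sub>R u" "t *\<^sub>R v"] that by simp
    also have "\<dots> \<le> h * norm u + h * norm v"
      using that by (intro add_mono mult_right_mono) auto
    finally have "norm (s *\<^sub>R u + t *\<^sub>R v) < r" using h by (simp add: algebra_simps)
    moreover have "dist x (x + (s *\<^sub>R u + t *\<^sub>R v)) = norm (s *\<^sub>R u + t *\<^sub>R v)"
      by (metis add_diff_cancel_left' dist_commute dist_norm)
    ultimately show ?thesis by (simp add: add.assoc)
  qed
  have inb0: "x + s *\<^sub>R u \<in> ball x r" if "0 \<le> s" "s \<le> h" for s
    using inb[OF that, of 0] h by simp
  define p where "p s = f ((x + h *\<^sub>R v) + s *\<^sub>R u) - f (x + s *\<^sub>R u)" for s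
  have "\<exists>s>0. s < h \<and> p h - p 0 =
      (h - 0) * (dir_deriv f u ((x + h *\<^sub>R v) + s *\<^sub>R u) - dir_deriv f u (x + s *\<^sub>R u))"
    unfolding p_def
    using inb[of _ h] inb0 h
    by (intro MVT2 DERIV_diff has_field_derivative_along_line[OF f]) (auto simp: add_ac)
  then obtain s where s: "0 < s" "s < h"
    and ps: "p h - p 0 = h * (dir_deriv f u ((x + h *\<^sub>R v) + s *\<^sub>R u) - dir_deriv f u (x + s *\<^sub>R u))"
    by auto
  have "\<exists>t>0. t < h \<and> dir_deriv f u ((x + s *\<^sub>R u) + h *\<^sub>R v) - dir_deriv f u ((x + s *\<^sub>R u) + 0 *\<^sub>R v) =
      (h - 0) * dir_deriv (dir_deriv f u) v ((x + s *\<^sub>R u) + t *\<^sub>R v)"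
    using inb[of s] s h
    by (intro MVT2 has_field_derivative_along_line[OF smooth_on_frechet_derivative[OF f]]) auto
  then obtain t where t: "0 < t" "t < h"
    and pt: "dir_deriv f u ((x + s *\<^sub>R u) + h *\<^sub>R v) - dir_deriv f u (x + s *\<^sub>R u) =
      h * dir_deriv (dir_deriv f u) v ((x + s *\<^sub>R u) + t *\<^sub>R v)"
    by auto
  have "p h - p 0 = h * h * dir_deriv (dir_deriv f u) v (x + s *\<^sub>R u + t *\<^sub>R v)"
    using ps pt by (simp add: add_ac)
  then show ?thesis using inb[of s t] s t by (auto simp: p_def add_ac intro!: bexI)
qed

text \<open>
  The second difference is symmetric in \<open>u\<close> and \<open>v\<close>, so the two mixed derivatives take equal values
  at two points of any small ball around \<open>x\<close>; by continuity they agree at \<open>x\<close>.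
\<close>

lemma dir_deriv_commute:
  fixes f :: "'e::euclidean_space \<Rightarrow> real"
  assumes f: "smooth_on S f" and S: "open S" "x \<in> S"
  shows "dir_deriv (dir_deriv f u) v x = dir_deriv (dir_deriv f v) u x"
proof (rule ccontr)
  assume ne: "\<not> ?thesis"
  define P where "P = dir_deriv (dir_deriv f u) v"
  define Q where "Q = dir_deriv (dir_deriv f v) u"
  define e where "e = \<bar>P x - Q x\<bar> / 2"
  have e: "e > 0" using ne by (simp add: e_def P_def Q_def)
  have "continuous_on S P" "continuous_on S Q"
    unfolding P_def Q_def
    by (intro smooth_on_continuous smooth_on_frechet_derivative f)+
  then have "isCont P x" "isCont Q x" using S by (auto simp: continuous_on_eq_continuous_at)
  then obtain r1 r2 where r1: "r1 > 0" "\<And>y. dist y x < r1 \<Longrightarrow> dist (P y) (P x) < e"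
    and r2: "r2 > 0" "\<And>y. dist y x < r2 \<Longrightarrow> dist (Q y) (Q x) < e"
    using e unfolding continuous_at by (metis continuous_at continuous_at_eps_delta)
  obtain r3 where r3: "r3 > 0" "ball x r3 \<subseteq> S" using S openE by blast
  define r where "r = min r1 (min r2 r3)"
  have r: "r > 0" using r1 r2 r3 by (simp add: r_def)
  have fr: "smooth_on (ball x r) f"
    by (rule smooth_on_subset[OF f]) (use r3 in \<open>auto simp: r_def\<close>)
  define h where "h = r / (2 * (norm u + norm v + 1))"
  have N: "norm u + norm v + 1 > 0" by (simp add: add_nonneg_pos)
  have h: "h > 0" using r N by (simp add: h_def)
  have "h * (norm u + norm v) < h * (2 * (norm u + norm v + 1))"
    using h N by (intro mult_strict_left_mono) auto
  also have "\<dots> = r" using N by (simp add: h_def)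
  finally have hr: "h * (norm u + norm v) < r" .
  obtain y where y: "y \<in> ball x r"
    "f (x + h *\<^sub>R u + h *\<^sub>R v) - f (x + h *\<^sub>R u) - f (x + h *\<^sub>R v) + f x = h * h * P y"
    using second_difference_mean_value[OF fr h hr] unfolding P_def by blast
  obtain z where z: "z \<in> ball x r"
    "f (x + h *\<^sub>R v + h *\<^sub>R u) - f (x + h *\<^sub>R v) - f (x + h *\<^sub>R u) + f x = h * h * Q z"
    using second_difference_mean_value[OF fr h, of v u] hr unfolding Q_def by (metis add.commute)
  have "h * h * P y = h * h * Q z" using y(2) z(2) by (simp add: algebra_simps)
  then have "P y = Q z" using h by simp
  moreover have "\<bar>P y - P x\<bar> < e" "\<bar>Q z - Q x\<bar> < e"
    using r1(2)[of y] r2(2)[of z] y(1) z(1) by (auto simp: r_def dist_commute dist_real_def)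
  ultimately show False unfolding e_def by (auto simp: abs_if split: if_splits)
qed


section \<open>The identity of 4-forms in coordinates\<close>

text \<open>
  Exterior differentiation of \<open>dF = 2a e \<and> F\<close> gives \<open>0 = 2 da \<and> e \<and> F + 2a de \<and> F - 2a e \<and> dF\<close>. The second
  term vanishes as \<open>de = 0\<close>, the third since \<open>e \<and> dF = 2a e \<and> e \<and> F = 0\<close>. The six terms of the conclusion are
  \<open>da \<and> e \<and> F\<close> evaluated on four constant vector fields.
\<close>

lemma da_wedge_e_wedge_F_eq_0:
  fixes a :: "'e::euclidean_space \<Rightarrow> real" and e :: "'e \<Rightarrow> 'e \<Rightarrow> real" and F :: "'e \<Rightarrow> 'e \<Rightarrow> 'e \<Rightarrow> real"
  assumes S: "open S" and x: "x \<in> S"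
    and a: "smooth_on S a" and e: "\<And>u. smooth_on S (e u)" and F: "\<And>u v. smooth_on S (F u v)"
    and skew: "\<And>y u v. y \<in> S \<Longrightarrow> F u v y = - F v u y"
    and de: "\<And>y u v. y \<in> S \<Longrightarrow> dir_deriv (e v) u y = dir_deriv (e u) v y"
    and dF: "\<And>y u v w. y \<in> S \<Longrightarrow> dir_deriv (F v w) u y + dir_deriv (F w u) v y + dir_deriv (F u v) w y =
      2 * a y * (e u y * F v w y + e v y * F w u y + e w y * F u v y)"
  shows "(dir_deriv a u x * e v x - dir_deriv a v x * e u x) * F w z x
       - (dir_deriv a u x * e w x - dir_deriv a w x * e u x) * F v z x
       + (dir_deriv a u x * e z x - dir_deriv a z x * e u x) * F v w x
       + (dir_deriv a v x * e w x - dir_deriv a w x * e v x) * F u z x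
       - (dir_deriv a v x * e z x - dir_deriv a z x * e v x) * F u w x
       + (dir_deriv a w x * e z x - dir_deriv a z x * e w x) * F u v x = 0"
proof -
  define G where "G t u v w = dir_deriv (dir_deriv (F v w) u) t x" for t u v w
  define K where "K t v w = dir_deriv (F v w) t x" for t v w
  define E where "E t u = dir_deriv (e u) t x" for t u
  have der: "(f has_derivative frechet_derivative f (at x)) (at x)" if "smooth_on S f" for f :: "'e \<Rightarrow> real"
    using smooth_on_has_derivative[OF that x] .
  have G_sym: "G t u v w = G u t v w" for t u v w
    unfolding G_def using dir_deriv_commute[OF F S x] .
  have F_skew: "F v w x = - F w v x" for v w by (rule skew[OF x])
  \<comment> \<open>\<open>G\<close>, \<open>K\<close> and \<open>E\<close> inherit the skewness of \<open>F\<close> and the closedness of \<open>e\<close>.\<close>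
  have F_skew_deriv: "dir_deriv (F w v) u y = - dir_deriv (F v w) u y" if "y \<in> S" for u v w y
  proof -
    have "frechet_derivative (F w v) (at y) = frechet_derivative (\<lambda>y. - F v w y) (at y)"
      by (rule frechet_derivative_transform_within_open[OF
            differentiableI[OF smooth_on_has_derivative[OF F that]] S that skew])
    also have "\<dots> = (\<lambda>u. - dir_deriv (F v w) u y)"
      by (intro frechet_derivative_eqI has_derivative_minus smooth_on_has_derivative[OF F that])
    finally show ?thesis by simp
  qed
  have K_skew: "K t w v = - K t v w" for t v w
    unfolding K_def by (rule F_skew_deriv[OF x])
  have G_skew: "G t u w v = - G t u v w" for t u v w
  proof -
    have sm: "smooth_on S (dir_deriv (F v w) u)" for u v w by (rule smooth_on_frechet_derivative[OF F])
    have "frechet_derivative (dir_deriv (F w v) u) (at x) = frechet_derivative (\<lambda>y. - dir_deriv (F v w) u y) (at x)"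
      by (rule frechet_derivative_transform_within_open[OF differentiableI[OF der[OF sm]] S x F_skew_deriv])
    also have "\<dots> = (\<lambda>t. - dir_deriv (dir_deriv (F v w) u) t x)"
      by (intro frechet_derivative_eqI has_derivative_minus der sm)
    finally show ?thesis unfolding G_def by simp
  qed
  have E_sym: "E t u = E u t" for t u unfolding E_def by (rule de[OF x])
  have K_cyc: "K u v w + K v w u + K w u v = 2 * a x * (e u x * F v w x + e v x * F w u x + e w x * F u v x)" for u v w
    unfolding K_def by (rule dF[OF x])
  have G_cyc: "G t u v w + G t v w u + G t w u v =
     2 * (dir_deriv a t x * (e u x * F v w x + e v x * F w u x + e w x * F u v x)
      + a x * (E t u * F v w x + e u x * K t v w + E t v * F w u x + e v x * K t w u
              + E t w * F u v x + e w x * K t u v))" for t u v w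
  proof -
    let ?L = "\<lambda>y. dir_deriv (F v w) u y + dir_deriv (F w u) v y + dir_deriv (F u v) w y"
    let ?R = "\<lambda>y. 2 * a y * (e u y * F v w y + e v y * F w u y + e w y * F u v y)"
    have L: "(?L has_derivative (\<lambda>t. G t u v w + G t v w u + G t w u v)) (at x)"
      unfolding G_def by (intro has_derivative_add der smooth_on_frechet_derivative F)
    have R: "(?R has_derivative (\<lambda>t. 2 * (dir_deriv a t x * (e u x * F v w x + e v x * F w u x + e w x * F u v x)
      + a x * (E t u * F v w x + e u x * K t v w + E t v * F w u x + e v x * K t w u
              + E t w * F u v x + e w x * K t u v)))) (at x)"
      unfolding E_def K_def
      by (auto intro!: derivative_eq_intros der[OF a] der[OF e] der[OF F] simp: algebra_simps)
    have "(?R has_derivative (\<lambda>t. G t u v w + G t v w u + G t w u v)) (at x)"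
      using has_derivative_transform_within_open[OF L S x] dF by simp
    from has_derivative_unique[OF this R] show ?thesis by meson
  qed
  define H where "H t u v w = G t u v w + G t v w u + G t w u v" for t u v w
  \<comment> \<open>The left-hand side of \<open>ddF = 0\<close>: each second derivative occurs twice, with opposite signs.\<close>
  have dd: "H u v w z - H v u w z + H w u v z - H z u v w = 0"
    unfolding H_def
    using G_sym[of u v] G_sym[of u w] G_sym[of u z] G_sym[of v w] G_sym[of v z] G_sym[of w z]
      G_skew[of _ _ z u] G_skew[of _ _ w u] G_skew[of _ _ z v] G_skew[of _ _ v u] G_skew[of _ _ z w] G_skew[of _ _ w v]
    by simp
  have red: "H t u v w = 2 * (dir_deriv a t x * (e u x * F v w x + e v x * F w u x + e w x * F u v x)
      + a x * (E t u * F v w x + E t v * F w u x + E t w * F u v x))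
      + 2 * a x * (e u x * K t v w + e v x * K t w u + e w x * K t u v)" for t u v w
    unfolding H_def G_cyc by (simp add: algebra_simps)
  \<comment> \<open>\<open>e \<and> dF = 2a e \<and> e \<and> F = 0\<close>\<close>
  have ek: "e u x * (K v w z + K w z v + K z v w) - e v x * (K u w z + K w z u + K z u w)
     + e w x * (K u v z + K v z u + K z u v) - e z x * (K u v w + K v w u + K w u v) = 0"
    unfolding K_cyc
    by (simp add: algebra_simps F_skew[of z u] F_skew[of w u] F_skew[of z v] F_skew[of v u] F_skew[of z w] F_skew[of w v])
  \<comment> \<open>Up to the factor 2, the Leibniz rule splits \<open>d(a e \<and> F)\<close> into \<open>da \<and> e \<and> F\<close>, \<open>a de \<and> F\<close> and \<open>- a e \<and> dF\<close>.\<close>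
  define Da where "Da = dir_deriv a u x * (e v x * F w z x + e w x * F z v x + e z x * F v w x)
    - dir_deriv a v x * (e u x * F w z x + e w x * F z u x + e z x * F u w x)
    + dir_deriv a w x * (e u x * F v z x + e v x * F z u x + e z x * F u v x)
    - dir_deriv a z x * (e u x * F v w x + e v x * F w u x + e w x * F u v x)"
  define EF where "EF = (E u v * F w z x + E u w * F z v x + E u z * F v w x)
    - (E v u * F w z x + E v w * F z u x + E v z * F u w x)
    + (E w u * F v z x + E w v * F z u x + E w z * F u v x)
    - (E z u * F v w x + E z v * F w u x + E z w * F u v x)"
  define eK where "eK = (e v x * K u w z + e w x * K u z v + e z x * K u v w)
    - (e u x * K v w z + e w x * K v z u + e z x * K v u w)
    + (e u x * K w v z + e v x * K w z u + e z x * K w u v)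
    - (e u x * K z v w + e v x * K z w u + e w x * K z u v)"
  have "EF = 0"
    unfolding EF_def by (simp add: E_sym[of v u] E_sym[of w u] E_sym[of w v] E_sym[of z u] E_sym[of z v]
      E_sym[of z w] F_skew[of z v] F_skew[of w u] algebra_simps)
  moreover have "eK = 0"
    unfolding eK_def using ek
    by (simp add: K_skew[of _ z v] K_skew[of _ z u] K_skew[of _ z w] K_skew[of _ v u]
      K_skew[of _ w u] K_skew[of _ w v] algebra_simps)
  moreover have "2 * Da + 2 * a x * EF + 2 * a x * eK = 0"
    using dd unfolding Da_def EF_def eK_def red by (simp add: algebra_simps)
  ultimately have "Da = 0" by simp
  then show ?thesis
    unfolding Da_def by (simp add: F_skew[of z u] F_skew[of w u] F_skew[of z v] algebra_simps)
qed


section \<open>Linear algebra of a paracontact tangent space\<close>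

text \<open>
  Pairing \<open>x\<close> with a vector of the orthonormal basis isolates one coordinate of \<open>x\<close>, up to sign.
\<close>

lemma has_signature_nondegenerate:
  assumes "has_signature B a b" "bilinear B" "\<And>v. B x v = 0"
  shows "x = 0"
proof -
  obtain P N where ind: "independent (P \<union> N)" and spn: "span (P \<union> N) = UNIV"
    and P: "\<And>u. u \<in> P \<Longrightarrow> B u u = 1" and N: "\<And>u. u \<in> N \<Longrightarrow> B u u = - 1"
    and orth: "\<And>u v. u \<in> P \<union> N \<Longrightarrow> v \<in> P \<union> N \<Longrightarrow> u \<noteq> v \<Longrightarrow> B u v = 0"
    using assms(1) unfolding has_signature_def by blast
  have fin: "finite (P \<union> N)" using ind by (rule independent_imp_finite)
  have "x \<in> span (P \<union> N)" using spn by simp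
  then obtain r where x: "x = (\<Sum>u\<in>P \<union> N. r u *\<^sub>R u)"
    unfolding span_finite[OF fin] by auto
  have "r v = 0" if v: "v \<in> P \<union> N" for v
  proof -
    have lin: "linear (\<lambda>x. B x v)" using assms(2) by (simp add: bilinear_def)
    have "B x v = (\<Sum>u\<in>P \<union> N. r u * B u v)"
      unfolding x using linear_sum[OF lin, of "\<lambda>u. r u *\<^sub>R u" "P \<union> N"] linear_cmul[OF lin] by simp
    also have "\<dots> = (\<Sum>u\<in>{v}. r u * B u v)"
      using v orth fin by (intro sum.mono_neutral_right) auto
    finally show ?thesis using assms(3)[of v] P[of v] N[of v] v by auto
  qed
  then show ?thesis unfolding x by simp
qed

lemma has_signature_transport:
  fixes B B' :: "'e::euclidean_space \<Rightarrow> 'e \<Rightarrow> real"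
  assumes "has_signature B a b" and T: "linear T" "inj T"
    and iso: "\<And>u v. B' (T u) (T v) = B u v"
  shows "has_signature B' a b"
proof -
  obtain P N where ind: "independent (P \<union> N)" and spn: "span (P \<union> N) = UNIV"
    and crd: "card P = a" "card N = b"
    and P: "\<forall>u\<in>P. B u u = 1" and N: "\<forall>u\<in>N. B u u = - 1"
    and orth: "\<forall>u \<in> P \<union> N. \<forall>v \<in> P \<union> N. u \<noteq> v \<longrightarrow> B u v = 0"
    using assms(1) unfolding has_signature_def by blast
  have inj: "inj_on T S" for S using T(2) by (rule inj_on_subset) simp
  show ?thesis unfolding has_signature_def
  proof (rule exI[of _ "T ` P"], rule exI[of _ "T ` N"], intro conjI)
    show "independent (T ` P \<union> T ` N)"
      using linear_independent_injective_image[OF T(1) ind] inj by (simp add: image_Un)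
    show "span (T ` P \<union> T ` N) = UNIV"
      using linear_span_image[OF T(1), of "P \<union> N"] spn linear_injective_imp_surjective[OF T]
      by (simp add: image_Un)
    show "card (T ` P) = a" "card (T ` N) = b" using crd inj by (simp_all add: card_image)
    show "\<forall>u\<in>T ` P. B' u u = 1" "\<forall>u\<in>T ` N. B' u u = - 1" using P N iso by auto
    show "\<forall>u\<in>T ` P \<union> T ` N. \<forall>v\<in>T ` P \<union> T ` N. u \<noteq> v \<longrightarrow> B' u v = 0"
      using orth by (auto simp: iso) (metis UnI1 UnI2)+
  qed
qed

text \<open>
  The structure that an almost paracontact metric manifold carries on each tangent space. Everything
  algebraic about the manifold is proved here, at a single point.
\<close>

locale paracontact_space =
  fixes n :: nat and \<phi> :: "'e::euclidean_space \<Rightarrow> 'e" and \<xi> :: 'e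
    and \<eta> :: "'e \<Rightarrow> real" and g :: "'e \<Rightarrow> 'e \<Rightarrow> real"
  assumes linear_phi: "linear \<phi>" and linear_eta: "linear \<eta>" and bilinear_g: "bilinear g"
    and g_sym: "g u v = g v u" and signature_g: "has_signature g (n + 1) n"
    and eta_xi: "\<eta> \<xi> = 1"
    and phi_phi: "\<phi> (\<phi> u) = u - \<eta> u *\<^sub>R \<xi>"
    and dim_plus: "dim {u. \<eta> u = 0 \<and> \<phi> u = u} = n"
    and dim_minus: "dim {u. \<eta> u = 0 \<and> \<phi> u = - u} = n"
    and g_phi_phi: "g (\<phi> u) (\<phi> v) = - g u v + \<eta> u * \<eta> v"
begin

lemmas phi_simps = linear_add[OF linear_phi] linear_diff[OF linear_phi] linear_cmul[OF linear_phi]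
  linear_0[OF linear_phi]
lemmas eta_simps = linear_add[OF linear_eta] linear_diff[OF linear_eta] linear_cmul[OF linear_eta]
  linear_0[OF linear_eta]
lemmas g_simps = bilinear_ladd[OF bilinear_g] bilinear_radd[OF bilinear_g]
  bilinear_lsub[OF bilinear_g] bilinear_rsub[OF bilinear_g]
  bilinear_lmul[OF bilinear_g] bilinear_rmul[OF bilinear_g]
  bilinear_lzero[OF bilinear_g] bilinear_rzero[OF bilinear_g]

lemma phi_xi: "\<phi> \<xi> = 0"
proof -
  have 0: "\<phi> (\<phi> \<xi>) = 0" by (simp add: phi_phi eta_xi)
  then have "\<phi> \<xi> = \<eta> (\<phi> \<xi>) *\<^sub>R \<xi>" using phi_phi[of "\<phi> \<xi>"] by (simp add: phi_simps)
  then have "0 = \<eta> (\<phi> \<xi>) *\<^sub>R \<phi> \<xi>" using 0 by (metis linear_cmul[OF linear_phi])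
  then show ?thesis using \<open>\<phi> \<xi> = \<eta> (\<phi> \<xi>) *\<^sub>R \<xi>\<close> by auto
qed

lemma eta_phi: "\<eta> (\<phi> u) = 0"
proof -
  have "\<phi> u = \<phi> u - \<eta> (\<phi> u) *\<^sub>R \<xi>"
    using phi_phi[of "\<phi> u"] by (simp add: phi_phi[of u] phi_simps phi_xi)
  then show ?thesis using eta_xi eta_simps(4) by auto
qed

lemma g_xi: "g u \<xi> = \<eta> u" "g \<xi> u = \<eta> u"
  using g_phi_phi[of u \<xi>] g_sym[of u \<xi>] by (simp_all add: phi_xi eta_xi g_simps)

lemma phi_skew: "g (\<phi> u) v = - g (\<phi> v) u"
proof -
  have "g (\<phi> (\<phi> u)) (\<phi> v) = - g (\<phi> u) v" using g_phi_phi[of "\<phi> u" v] by (simp add: eta_phi)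
  moreover have "g (\<phi> (\<phi> u)) (\<phi> v) = g u (\<phi> v)" by (simp add: phi_phi g_simps g_xi eta_phi)
  ultimately show ?thesis using g_sym[of u "\<phi> v"] by simp
qed

text \<open>
  For \<open>n \<ge> 2\<close>, the wedge product with the fundamental form \<open>\<Phi>\<close> is injective on the 1-forms of the space
  \<open>ker \<eta>\<close>. Contracting \<open>a \<and> \<eta> \<and> \<Phi> = 0\<close> with \<open>\<xi>\<close> leaves \<open>a \<and> \<Phi> = 0\<close> on \<open>ker \<eta>\<close>. If \<open>u\<close> and \<open>w\<close> lie in the
  same eigenspace of \<open>\<phi>\<close> in \<open>ker \<eta>\<close>, which is isotropic, then \<open>\<Phi>(u,w) = 0\<close> and the identity says that
  \<open>a(u) w - a(w) u\<close> is orthogonal to everything, hence zero. So \<open>a(u) \<noteq> 0\<close> would confine the whole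
  eigenspace to the line of \<open>u\<close>, although its dimension is \<open>n \<ge> 2\<close>. Thus \<open>a\<close> vanishes on both eigenspaces,
  and they span \<open>ker \<eta>\<close>.
\<close>

lemma wedge_fundamental_form_cancel:
  fixes a :: "'e \<Rightarrow> real"
  assumes n: "n \<ge> 2" and a: "linear a"
    and wedge: "\<And>u v w z.
         (a u * \<eta> v - a v * \<eta> u) * g (\<phi> w) z - (a u * \<eta> w - a w * \<eta> u) * g (\<phi> v) z
       + (a u * \<eta> z - a z * \<eta> u) * g (\<phi> v) w + (a v * \<eta> w - a w * \<eta> v) * g (\<phi> u) z
       - (a v * \<eta> z - a z * \<eta> v) * g (\<phi> u) w + (a w * \<eta> z - a z * \<eta> w) * g (\<phi> u) v = 0"
  shows "a u = a \<xi> * \<eta> u"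
proof -
  have zero: "a u = 0" if u: "\<eta> u = 0" "\<phi> u = s *\<^sub>R u" and s: "s = 1 \<or> s = - 1" for s u
  proof (rule ccontr)
    assume au: "a u \<noteq> 0"
    have s2: "s * s = 1" using s by auto
    have "w \<in> span {u}" if w: "\<eta> w = 0" "\<phi> w = s *\<^sub>R w" for w
    proof -
      \<comment> \<open>The eigenspaces are isotropic because \<open>\<phi>\<close> is an anti-isometry of \<open>ker \<eta>\<close>.\<close>
      have "s * s * g u w = - g u w" using g_phi_phi[of u w] u w by (simp add: g_simps)
      then have uw: "g u w = 0" using s2 by simp
      have "g (a u *\<^sub>R w - a w *\<^sub>R u) v = 0" for v
      proof -
        define z where "z = v - \<eta> v *\<^sub>R \<xi>"
        have z: "\<eta> z = 0" by (simp add: z_def eta_simps eta_xi)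
        have "a u * g (\<phi> w) z = a w * g (\<phi> u) z"
          using wedge[of u \<xi> w z] u w z uw by (simp add: eta_xi phi_xi g_simps)
        then have "s * (a u * g w z) = s * (a w * g u z)" using u w by (simp add: g_simps mult_ac)
        then have "a u * g w z = a w * g u z" using s by auto
        then show ?thesis using u w by (simp add: z_def g_simps g_xi)
      qed
      then have "a u *\<^sub>R w = a w *\<^sub>R u"
        using has_signature_nondegenerate[OF signature_g bilinear_g, of "a u *\<^sub>R w - a w *\<^sub>R u"] by simp
      then have "w = (a w / a u) *\<^sub>R u"
        using au by (metis (no_types) divide_inverse_commute scaleR_left_imp_eq scaleR_scaleR
            right_inverse scaleR_one mult.commute)
      then show ?thesis by (metis span_base span_scale singletonI)
    qed
    then have "{w. \<eta> w = 0 \<and> \<phi> w = s *\<^sub>R w} \<subseteq> span {u}" by blast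
    from dim_le_card[OF this] have "dim {w. \<eta> w = 0 \<and> \<phi> w = s *\<^sub>R w} \<le> 1" by simp
    then show False using s dim_plus dim_minus n by auto
  qed
  \<comment> \<open>The projections of \<open>u\<close> to the two eigenspaces are \<open>(x + \<phi> x)/2\<close> and \<open>(x - \<phi> x)/2\<close>.\<close>
  define x where "x = u - \<eta> u *\<^sub>R \<xi>"
  have x: "\<eta> x = 0" by (simp add: x_def eta_simps eta_xi)
  have "a (x + \<phi> x) = 0"
    by (rule zero[of _ 1]) (simp_all add: eta_simps phi_simps eta_phi x phi_phi)
  moreover have "a (x - \<phi> x) = 0"
    by (rule zero[of _ "-1"]) (simp_all add: eta_simps phi_simps eta_phi x phi_phi)
  ultimately have "a x = 0" by (simp add: linear_add[OF a] linear_diff[OF a])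
  then show ?thesis by (simp add: x_def linear_diff[OF a] linear_cmul[OF a] mult.commute)
qed

text \<open>
  The map that multiplies \<open>ker \<eta>\<close> by \<open>1/sqrt \<gamma>\<close> and \<open>\<xi>\<close> by \<open>1/\<beta>\<close> is an isometry from \<open>g\<close> to the deformed metric,
  because \<open>ker \<eta>\<close> and \<open>\<xi>\<close> are orthogonal for both.
\<close>

lemma signature_deformed:
  assumes "\<gamma> > 0" "\<beta> \<noteq> 0"
  shows "has_signature (\<lambda>u v. \<gamma> * g u v + (\<beta>\<^sup>2 - \<gamma>) * \<eta> u * \<eta> v) (n + 1) n"
proof -
  obtain r where r: "r > 0" "\<gamma> = r * r"
    using assms(1) by (metis real_sqrt_gt_zero real_sqrt_mult_self abs_of_pos)
  define T where "T u = (1 / r) *\<^sub>R (u - \<eta> u *\<^sub>R \<xi>) + (\<eta> u / \<beta>) *\<^sub>R \<xi>" for u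
  have T: "linear T"
    by (rule linearI) (simp_all add: T_def eta_simps algebra_simps add_divide_distrib)
  have eta_T: "\<eta> (T u) = \<eta> u / \<beta>" for u by (simp add: T_def eta_simps eta_xi)
  have inj: "inj T"
  proof (rule linear_injective_0[OF T, THEN iffD2], intro allI impI)
    fix u assume Tu: "T u = 0"
    then have "\<eta> u = 0" using eta_T[of u] assms by (simp add: eta_simps)
    with Tu show "u = 0" using r by (simp add: T_def)
  qed
  have isometry: "\<gamma> * g (T u) (T v) + (\<beta>\<^sup>2 - \<gamma>) * \<eta> (T u) * \<eta> (T v) = g u v" for u v
  proof -
    let ?p = "\<lambda>u. u - \<eta> u *\<^sub>R \<xi>"
    have "g (?p u) (?p v) = g u v - \<eta> u * \<eta> v" "g (?p u) \<xi> = 0" "g \<xi> (?p v) = 0" "g \<xi> \<xi> = 1"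
      by (simp_all add: g_simps g_xi eta_simps eta_xi)
    then have "g (T u) (T v) = (1 / r) * ((1 / r) * (g u v - \<eta> u * \<eta> v)) + (\<eta> u / \<beta>) * (\<eta> v / \<beta>)"
      unfolding T_def g_simps(1,2,5,6) by simp
    then have "\<gamma> * g (T u) (T v) = g u v - \<eta> u * \<eta> v + \<gamma> * (\<eta> u / \<beta>) * (\<eta> v / \<beta>)"
      using r by (simp add: distrib_left)
    moreover have "\<beta>\<^sup>2 * (\<eta> u / \<beta>) * (\<eta> v / \<beta>) = \<eta> u * \<eta> v"
      using assms(2) by (simp add: power2_eq_square)
    ultimately show ?thesis unfolding eta_T by (simp add: left_diff_distrib diff_divide_distrib)
  qed
  show ?thesis by (rule has_signature_transport[OF signature_g T inj]) (rule isometry)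
qed

lemma paracontact_space_deformed:
  assumes "\<gamma> > 0" "\<beta> \<noteq> 0"
  shows "paracontact_space n \<phi> ((1 / \<beta>) *\<^sub>R \<xi>) (\<lambda>u. \<beta> * \<eta> u)
           (\<lambda>u v. \<gamma> * g u v + (\<beta>\<^sup>2 - \<gamma>) * \<eta> u * \<eta> v)"
proof (rule paracontact_space.intro)
  show "linear (\<lambda>u. \<beta> * \<eta> u)" by (rule linearI) (simp_all add: eta_simps algebra_simps)
  show "bilinear (\<lambda>u v. \<gamma> * g u v + (\<beta>\<^sup>2 - \<gamma>) * \<eta> u * \<eta> v)"
    unfolding bilinear_def
    by (intro conjI allI linearI) (simp_all add: g_simps eta_simps algebra_simps)
  show "has_signature (\<lambda>u v. \<gamma> * g u v + (\<beta>\<^sup>2 - \<gamma>) * \<eta> u * \<eta> v) (n + 1) n"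
    by (rule signature_deformed[OF assms])
  show "\<phi> (\<phi> u) = u - (\<beta> * \<eta> u) *\<^sub>R (1 / \<beta>) *\<^sub>R \<xi>" for u
    using assms by (simp add: phi_phi)
  show "\<beta> * \<eta> ((1 / \<beta>) *\<^sub>R \<xi>) = 1" using assms by (simp add: eta_simps eta_xi)
  show "dim {u. \<beta> * \<eta> u = 0 \<and> \<phi> u = u} = n" "dim {u. \<beta> * \<eta> u = 0 \<and> \<phi> u = - u} = n"
    using assms dim_plus dim_minus by simp_all
  show "\<gamma> * g (\<phi> u) (\<phi> v) + (\<beta>\<^sup>2 - \<gamma>) * \<eta> (\<phi> u) * \<eta> (\<phi> v) =
      - (\<gamma> * g u v + (\<beta>\<^sup>2 - \<gamma>) * \<eta> u * \<eta> v) + \<beta> * \<eta> u * (\<beta> * \<eta> v)" for u v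
    by (simp add: g_phi_phi eta_phi power2_eq_square algebra_simps)
  show "\<gamma> * g u v + (\<beta>\<^sup>2 - \<gamma>) * \<eta> u * \<eta> v = \<gamma> * g v u + (\<beta>\<^sup>2 - \<gamma>) * \<eta> v * \<eta> u" for u v
    using g_sym[of u v] by simp
  show "linear \<phi>" by (rule linear_phi)
qed

end


section \<open>Smoothness and differentiation in charts\<close>

lemma chart_inv_chart:
  assumes "is_chart X c" "p \<in> fst c"
  shows "chart_inv c (snd c p) = p"
proof -
  have "inj_on (snd c) (fst c)"
    using assms(1) unfolding is_chart_def homeomorphic_eq_everything_map
    by (metis inf.absorb_iff2 openin_subset topspace_subtopology)
  then show ?thesis using assms(2) by (simp add: chart_inv_def)
qed

lemma open_chart_image:
  assumes c: "is_chart X c" and W: "openin X W"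
  shows "open (snd c ` (fst c \<inter> W))"
proof -
  have "open_map (subtopology X (fst c)) (top_of_set (snd c ` fst c)) (snd c)"
    using c unfolding is_chart_def by (blast intro: homeomorphic_imp_open_map)
  moreover have "openin (subtopology X (fst c)) (fst c \<inter> W)"
    using W by (auto simp: openin_subtopology)
  ultimately have "openin (top_of_set (snd c ` fst c)) (snd c ` (fst c \<inter> W))"
    unfolding open_map_def by blast
  then show ?thesis using c unfolding is_chart_def by (blast intro: openin_open_trans)
qed

lemma smooth_in_chart_cong:
  assumes "is_chart X c" "openin X W" "\<And>p. p \<in> fst c \<inter> W \<Longrightarrow> f p = h p" "smooth_in_chart c W f"
  shows "smooth_in_chart c W h"
  using assms(4) unfolding smooth_in_chart_def
  by (rule smooth_on_cong[OF open_chart_image[OF assms(1,2)], rotated])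
    (auto simp: chart_inv_chart[OF assms(1)] assms(3))

lemma smooth_in_chart_subset: "smooth_in_chart c V f \<Longrightarrow> W \<subseteq> V \<Longrightarrow> smooth_in_chart c W f"
  unfolding smooth_in_chart_def by (erule smooth_on_subset) auto

lemma smooth_in_chart_const: "smooth_in_chart c W (\<lambda>_. k)"
  unfolding smooth_in_chart_def comp_def by (rule smooth_on_const)

lemma smooth_in_chart_add:
  "is_chart X c \<Longrightarrow> openin X W \<Longrightarrow> smooth_in_chart c W f \<Longrightarrow> smooth_in_chart c W h \<Longrightarrow>
    smooth_in_chart c W (\<lambda>p. f p + h p)"
  unfolding smooth_in_chart_def comp_def by (intro smooth_on_add open_chart_image)

lemma smooth_in_chart_mult:
  fixes f h :: "'a \<Rightarrow> real"
  shows "is_chart X c \<Longrightarrow> openin X W \<Longrightarrow> smooth_in_chart c W f \<Longrightarrow> smooth_in_chart c W h \<Longrightarrow>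
    smooth_in_chart c W (\<lambda>p. f p * h p)"
  unfolding smooth_in_chart_def comp_def by (intro smooth_on_mult open_chart_image)

lemma smooth_in_chart_scaleR:
  "is_chart X c \<Longrightarrow> openin X W \<Longrightarrow> smooth_in_chart c W f \<Longrightarrow> smooth_in_chart c W h \<Longrightarrow>
    smooth_in_chart c W (\<lambda>p. f p *\<^sub>R h p)"
  unfolding smooth_in_chart_def comp_def by (intro smooth_on_scaleR open_chart_image)

lemma smooth_in_chart_inverse:
  fixes f :: "'a \<Rightarrow> real"
  assumes "is_chart X c" "openin X W" "smooth_in_chart c W f" "\<And>p. p \<in> W \<Longrightarrow> f p \<noteq> 0"
  shows "smooth_in_chart c W (\<lambda>p. inverse (f p))"
  using assms(3) unfolding smooth_in_chart_def comp_def
  by (intro smooth_on_inverse open_chart_image[OF assms(1,2)])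
    (auto simp: chart_inv_chart[OF assms(1)] assms(4))

text \<open>
  Smoothness of a tensor field in a chart is smoothness of its coefficients on constant vectors. To
  insert a varying vector field into a slot, it is expanded in the standard basis.
\<close>

lemma smooth_in_chart_bilinear_comp:
  fixes B :: "'a \<Rightarrow> 'e::euclidean_space \<Rightarrow> 'e \<Rightarrow> real" and Z :: "'a \<Rightarrow> 'e"
  assumes c: "is_chart X c" "openin X W"
    and lin: "\<And>p. p \<in> fst c \<inter> W \<Longrightarrow> bilinear (B p)"
    and B: "\<And>u v. smooth_in_chart c W (\<lambda>p. B p u v)" and Z: "smooth_in_chart c W Z"
  shows "smooth_in_chart c W (\<lambda>p. B p (Z p) v)"
proof (rule smooth_in_chart_cong[OF c])
  show "smooth_in_chart c W (\<lambda>p. \<Sum>b\<in>Basis. (Z p \<bullet> b) * B p b v)"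
    using B Z open_chart_image[OF c] unfolding smooth_in_chart_def comp_def
    by (intro smooth_on_sum smooth_on_mult smooth_on_inner smooth_on_const)
  fix p assume "p \<in> fst c \<inter> W"
  then have l: "linear (\<lambda>u. B p u v)" using lin by (simp add: bilinear_def)
  have "B p (Z p) v = B p (\<Sum>b\<in>Basis. (Z p \<bullet> b) *\<^sub>R b) v" by (simp add: euclidean_representation)
  also have "\<dots> = (\<Sum>b\<in>Basis. (Z p \<bullet> b) * B p b v)"
    using linear_sum[OF l, of "\<lambda>b. (Z p \<bullet> b) *\<^sub>R b" Basis] linear_cmul[OF l] by simp
  finally show "(\<Sum>b\<in>Basis. (Z p \<bullet> b) * B p b v) = B p (Z p) v" ..
qed

lemma smooth_in_chart_has_derivative:
  "smooth_in_chart c W f \<Longrightarrow> p \<in> fst c \<inter> W \<Longrightarrow>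
    ((f \<circ> chart_inv c) has_derivative chart_deriv c f p) (at (snd c p))"
  unfolding smooth_in_chart_def chart_deriv_def by (rule smooth_on_has_derivative) auto

lemma chart_deriv_eqI:
  assumes c: "is_chart X c" "openin X W" "p \<in> fst c \<inter> W"
    and der: "((f \<circ> chart_inv c) has_derivative D) (at (snd c p))"
    and eq: "\<And>q. q \<in> fst c \<inter> W \<Longrightarrow> f q = h q"
  shows "chart_deriv c h p = D"
proof -
  have "((h \<circ> chart_inv c) has_derivative D) (at (snd c p))"
    by (rule has_derivative_transform_within_open[OF der open_chart_image[OF c(1,2)]])
      (use c eq in \<open>auto simp: chart_inv_chart[OF c(1)]\<close>)
  then have "frechet_derivative (h \<circ> chart_inv c) (at (snd c p)) = D"
    by (rule frechet_derivative_eqI)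
  then show ?thesis unfolding chart_deriv_def by simp
qed

lemma openin_nonzero_in_chart:
  fixes f :: "'a \<Rightarrow> real"
  assumes c: "is_chart X c" and f: "smooth_in_chart c (topspace X) f"
  shows "openin X {p \<in> fst c. f p \<noteq> 0}"
proof -
  have sub: "fst c \<subseteq> topspace X" using c unfolding is_chart_def by (simp add: openin_subset)
  then have [simp]: "fst c \<inter> topspace X = fst c" by blast
  define V where "V = {y \<in> snd c ` fst c. (f \<circ> chart_inv c) y \<noteq> 0}"
  have "continuous_on (snd c ` fst c) (f \<circ> chart_inv c)"
    using f smooth_on_continuous[of "snd c ` fst c" "f \<circ> chart_inv c"]
    unfolding smooth_in_chart_def by simp
  then have "openin (top_of_set (snd c ` fst c)) ((snd c ` fst c) \<inter> (f \<circ> chart_inv c) -` (- {0}))"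
    by (rule continuous_openin_preimage_gen) auto
  moreover have "(snd c ` fst c) \<inter> (f \<circ> chart_inv c) -` (- {0}) = V" by (auto simp: V_def)
  moreover have "continuous_map (subtopology X (fst c)) (top_of_set (snd c ` fst c)) (snd c)"
    using c unfolding is_chart_def by (blast intro: homeomorphic_imp_continuous_map)
  ultimately have "openin (subtopology X (fst c)) {p \<in> topspace (subtopology X (fst c)). snd c p \<in> V}"
    by (intro openin_continuous_map_preimage) simp_all
  moreover have "snd c p \<in> V \<longleftrightarrow> f p \<noteq> 0" if "p \<in> fst c" for p
    using that by (simp add: V_def chart_inv_chart[OF c that])
  then have "{p \<in> topspace (subtopology X (fst c)). snd c p \<in> V} = {p \<in> fst c. f p \<noteq> 0}"
    using sub by auto
  ultimately show ?thesis
    using c unfolding is_chart_def by (metis openin_trans_full)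
qed


section \<open>Almost paracosymplectic manifolds\<close>

text \<open>
  The manifold structure falls apart into three kinds of conditions, with different behaviour under
  deformations: the algebra of each tangent space, smoothness of coefficients in each chart, and
  compatibility with changes of charts.
\<close>

lemma almost_paracontact_metric_on_iff:
  fixes X :: "'a topology" and A :: "('a, 'e::euclidean_space) chart set"
  shows "almost_paracontact_metric_on X A n W S \<longleftrightarrow>
    smooth_manifold X A \<and> DIM('e) = 2 * n + 1 \<and> openin X W \<and>
    (\<forall>c\<in>A. \<forall>p \<in> fst c \<inter> W.
       paracontact_space n (phi S c p) (xi S c p) (eta S c p) (metric S c p)) \<and>
    (\<forall>c\<in>A. smooth_in_chart c W (xi S c) \<and>
       (\<forall>u. smooth_in_chart c W (\<lambda>p. phi S c p u)) \<and>
       (\<forall>u. smooth_in_chart c W (\<lambda>p. eta S c p u)) \<and>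
       (\<forall>u v. smooth_in_chart c W (\<lambda>p. metric S c p u v))) \<and>
    (\<forall>c\<in>A. \<forall>d\<in>A. \<forall>p \<in> fst c \<inter> fst d \<inter> W.
       xi S d p = jac c d p (xi S c p) \<and>
       (\<forall>u. phi S d p (jac c d p u) = jac c d p (phi S c p u)) \<and>
       (\<forall>u. eta S d p (jac c d p u) = eta S c p u) \<and>
       (\<forall>u v. metric S d p (jac c d p u) (jac c d p v) = metric S c p u v))"
  unfolding almost_paracontact_metric_on_def endo_field_def one_form_def vector_field_def
    pseudo_riemannian_metric_def bilinear_field_def paracontact_space_def
    ball_conj_distrib all_conj_distrib
  by (rule iffI; elim conjE; intro conjI; assumption)

lemma paracontact_space_at:
  "almost_paracontact_metric_on X A n W S \<Longrightarrow> c \<in> A \<Longrightarrow> p \<in> fst c \<inter> W \<Longrightarrow>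
    paracontact_space n (phi S c p) (xi S c p) (eta S c p) (metric S c p)"
  unfolding almost_paracontact_metric_on_iff by blast

lemma almost_paracontact_metric_onD:
  assumes "almost_paracontact_metric_on X A n W S"
  shows "openin X W" "c \<in> A \<Longrightarrow> is_chart X c"
    "c \<in> A \<Longrightarrow> smooth_in_chart c W (xi S c)"
    "c \<in> A \<Longrightarrow> smooth_in_chart c W (\<lambda>p. phi S c p u)"
    "c \<in> A \<Longrightarrow> smooth_in_chart c W (\<lambda>p. eta S c p u)"
    "c \<in> A \<Longrightarrow> smooth_in_chart c W (\<lambda>p. metric S c p u v)"
  using assms unfolding almost_paracontact_metric_on_iff smooth_manifold_def smooth_atlas_def by blast+

lemma smooth_fundamental_form:
  assumes S: "almost_paracontact_metric_on X A n W S" and c: "c \<in> A"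
  shows "smooth_in_chart c W (\<lambda>p. fundamental_form S c p u v)"
  unfolding fundamental_form_def
  by (rule smooth_in_chart_bilinear_comp[OF almost_paracontact_metric_onD(2)[OF S c]
        almost_paracontact_metric_onD(1)[OF S]])
    (use paracontact_space.bilinear_g[OF paracontact_space_at[OF S c]]
      almost_paracontact_metric_onD(4,6)[OF S c] in auto)

text \<open>
  The only place where \<open>n \<ge> 2\<close> enters: \<open>\<Phi>\<close> is cancelled from \<open>d\<alpha> \<and> \<eta> \<and> \<Phi> = 0\<close>, the consequence of \<open>dd\<Phi> = 0\<close>.
\<close>

lemma d_alpha_wedge_eta:
  assumes S: "almost_paracosymplectic_on X A n W \<alpha> S" and n: "n \<ge> 2"
    and c: "c \<in> A" and p: "p \<in> fst c \<inter> W"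
  shows "wedge11 (d0 \<alpha>) (eta S) c p u v = 0"
proof -
  have P: "almost_paracontact_metric_on X A n W S"
    and \<alpha>: "smooth_in_chart c W \<alpha>"
    and closed: "\<And>q u v. q \<in> fst c \<inter> W \<Longrightarrow> d1 (eta S) c q u v = 0"
    and d\<Phi>: "\<And>q u v w. q \<in> fst c \<inter> W \<Longrightarrow> d2 (fundamental_form S) c q u v w =
                   2 * \<alpha> q * wedge12 (eta S) (fundamental_form S) c q u v w"
    using S c unfolding almost_paracosymplectic_on_def smooth_function_def by blast+
  note PD = almost_paracontact_metric_onD[OF P]
  interpret paracontact_space n "phi S c p" "xi S c p" "eta S c p" "metric S c p"
    by (rule paracontact_space_at[OF P c p])
  have inv: "chart_inv c (snd c q) = q" if "q \<in> fst c \<inter> W" for q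
    using chart_inv_chart[OF PD(2)[OF c]] that by simp
  let ?O = "snd c ` (fst c \<inter> W)"
  define a where "a = \<alpha> \<circ> chart_inv c"
  define e where "e u = (\<lambda>q. eta S c q u) \<circ> chart_inv c" for u
  define F where "F u v = (\<lambda>q. fundamental_form S c q u v) \<circ> chart_inv c" for u v
  have skew: "F u v y = - F v u y" if y: "y \<in> ?O" for u v y
  proof -
    obtain q where q: "q \<in> fst c \<inter> W" "y = snd c q" using y by blast
    show ?thesis
      using paracontact_space.phi_skew[OF paracontact_space_at[OF P c q(1)], of u v]
      by (simp add: F_def q(2) inv[OF q(1)] fundamental_form_def)
  qed
  have de: "dir_deriv (e v) u y = dir_deriv (e u) v y" if y: "y \<in> ?O" for u v y
  proof -
    obtain q where q: "q \<in> fst c \<inter> W" "y = snd c q" using y by blast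
    show ?thesis using closed[OF q(1), of u v] by (simp add: d1_def chart_deriv_def e_def q(2))
  qed
  have dF: "dir_deriv (F v w) u y + dir_deriv (F w u) v y + dir_deriv (F u v) w y =
      2 * a y * (e u y * F v w y + e v y * F w u y + e w y * F u v y)" if y: "y \<in> ?O" for u v w y
  proof -
    obtain q where q: "q \<in> fst c \<inter> W" "y = snd c q" using y by blast
    show ?thesis using d\<Phi>[OF q(1), of u v w]
      by (simp add: d2_def wedge12_def chart_deriv_def a_def e_def F_def q(2) inv[OF q(1)])
  qed
  have a: "smooth_on ?O a" and e: "smooth_on ?O (e u)" and F: "smooth_on ?O (F u v)" for u v
    using \<alpha> PD(5)[OF c] smooth_fundamental_form[OF P c]
    unfolding smooth_in_chart_def a_def e_def F_def by auto
  let ?da = "frechet_derivative a (at (snd c p))"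
  have O: "open ?O" "snd c p \<in> ?O" using open_chart_image[OF PD(2)[OF c] PD(1)] p by auto
  have "?da w = ?da (xi S c p) * eta S c p w" for w
  proof (rule wedge_fundamental_form_cancel[OF n])
    show "linear ?da" using smooth_on_has_derivative[OF a O(2)] by (rule has_derivative_linear)
  next
    fix u v w z
    from da_wedge_e_wedge_F_eq_0[OF O a e F skew de dF, of u v w z]
    show "(?da u * eta S c p v - ?da v * eta S c p u) * metric S c p (phi S c p w) z
       - (?da u * eta S c p w - ?da w * eta S c p u) * metric S c p (phi S c p v) z
       + (?da u * eta S c p z - ?da z * eta S c p u) * metric S c p (phi S c p v) w
       + (?da v * eta S c p w - ?da w * eta S c p v) * metric S c p (phi S c p u) z
       - (?da v * eta S c p z - ?da z * eta S c p v) * metric S c p (phi S c p u) w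
       + (?da w * eta S c p z - ?da z * eta S c p w) * metric S c p (phi S c p u) v = 0"
      by (simp add: e_def F_def inv[OF p] fundamental_form_def)
  qed
  then have "d0 \<alpha> c p w = d0 \<alpha> c p (xi S c p) * eta S c p w" for w
    unfolding d0_def chart_deriv_def a_def .
  from this[of u] this[of v] show ?thesis by (simp add: wedge11_def)
qed


section \<open>Homothetic deformations\<close>

lemma almost_paracontact_metric_on_subset:
  assumes S: "almost_paracontact_metric_on X A n V S" and W: "openin X W" "W \<subseteq> V"
  shows "almost_paracontact_metric_on X A n W S"
  unfolding almost_paracontact_metric_on_iff
  by (intro conjI ballI allI smooth_in_chart_subset[OF _ W(2)];
      use S[unfolded almost_paracontact_metric_on_iff] W in blast)

lemma almost_paracosymplectic_on_subset:
  assumes S: "almost_paracosymplectic_on X A n V \<alpha> S" and W: "openin X W" "W \<subseteq> V"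
  shows "almost_paracosymplectic_on X A n W \<alpha> S"
  using S almost_paracontact_metric_on_subset[OF _ W, of A n S] W(2) smooth_in_chart_subset[OF _ W(2)]
  unfolding almost_paracosymplectic_on_def smooth_function_def by blast

text \<open>
  The deformed tangent spaces are covered by \<open>paracontact_space_deformed\<close>; the deformed tensors are
  smooth and tensorial because they are algebraic expressions, with smooth coefficients that do not
  depend on the chart, in the given ones.
\<close>

lemma almost_paracontact_metric_on_D_deformation:
  fixes X :: "'a topology" and A :: "('a, 'e::euclidean_space) chart set"
  assumes S: "almost_paracontact_metric_on X A n W S" and D: "D_admissible_on A W \<gamma> \<beta> S"
  shows "almost_paracontact_metric_on X A n W (D_deformation \<gamma> \<beta> S)"
proof -
  let ?S = "D_deformation \<gamma> \<beta> S"
  note SD = almost_paracontact_metric_onD[OF S]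
  have \<gamma>: "\<gamma> > 0" and \<beta>: "c \<in> A \<Longrightarrow> smooth_in_chart c W \<beta>" and \<beta>0: "p \<in> W \<Longrightarrow> \<beta> p \<noteq> 0" for c p
    using D unfolding D_admissible_on_def smooth_function_def by auto
  have space: "paracontact_space n (phi ?S c p) (xi ?S c p) (eta ?S c p) (metric ?S c p)"
    if "c \<in> A" "p \<in> fst c \<inter> W" for c p
    using paracontact_space.paracontact_space_deformed[OF paracontact_space_at[OF S that] \<gamma>] \<beta>0 that
    by (simp add: D_deformation_def)
  have smooth_xi: "smooth_in_chart c W (xi ?S c)"
    and smooth_eta: "smooth_in_chart c W (\<lambda>p. eta ?S c p u)"
    and smooth_metric: "smooth_in_chart c W (\<lambda>p. metric ?S c p u v)" if c: "c \<in> A" for c u v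
  proof -
    note rls = smooth_in_chart_add[OF SD(2)[OF c] SD(1)] smooth_in_chart_mult[OF SD(2)[OF c] SD(1)]
      smooth_in_chart_scaleR[OF SD(2)[OF c] SD(1)] smooth_in_chart_const
      smooth_in_chart_inverse[OF SD(2)[OF c] SD(1) \<beta>[OF c] \<beta>0] \<beta>[OF c] SD(3,5,6)[OF c]
    have "smooth_in_chart c W (\<lambda>p. inverse (\<beta> p) *\<^sub>R xi S c p)"
      by (intro rls)
    then show "smooth_in_chart c W (xi ?S c)" by (simp add: D_deformation_def inverse_eq_divide)
    show "smooth_in_chart c W (\<lambda>p. eta ?S c p u)"
      by (simp add: D_deformation_def) (intro rls)
    have "smooth_in_chart c W (\<lambda>p. \<gamma> * metric S c p u v + (\<beta> p * \<beta> p + (- \<gamma>)) * eta S c p u * eta S c p v)"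
      by (intro rls)
    then show "smooth_in_chart c W (\<lambda>p. metric ?S c p u v)"
      by (simp add: D_deformation_def power2_eq_square)
  qed
  have linear_jac: "linear (jac c d p)" if c: "c \<in> A" "d \<in> A" and p: "p \<in> fst c \<inter> fst d \<inter> W" for c d p
  proof -
    have "smooth_on (snd c ` (fst c \<inter> fst d)) (transition c d)"
      using S c unfolding almost_paracontact_metric_on_def smooth_manifold_def smooth_atlas_def by blast
    then show ?thesis
      unfolding jac_def by (rule has_derivative_linear[OF smooth_on_has_derivative]) (use p in auto)
  qed
  have tensorial: "xi ?S d p = jac c d p (xi ?S c p)"
      "phi ?S d p (jac c d p u) = jac c d p (phi ?S c p u)"
      "eta ?S d p (jac c d p u) = eta ?S c p u"
      "metric ?S d p (jac c d p u) (jac c d p v) = metric ?S c p u v"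
    if "c \<in> A" "d \<in> A" "p \<in> fst c \<inter> fst d \<inter> W" for c d p u v
  proof -
    have "xi S d p = jac c d p (xi S c p)"
      and "\<And>u. phi S d p (jac c d p u) = jac c d p (phi S c p u)"
      and "\<And>u. eta S d p (jac c d p u) = eta S c p u"
      and "\<And>u v. metric S d p (jac c d p u) (jac c d p v) = metric S c p u v"
      using S that unfolding almost_paracontact_metric_on_iff by blast+
    then show "xi ?S d p = jac c d p (xi ?S c p)"
      and "phi ?S d p (jac c d p u) = jac c d p (phi ?S c p u)"
      and "eta ?S d p (jac c d p u) = eta ?S c p u"
      and "metric ?S d p (jac c d p u) (jac c d p v) = metric ?S c p u v"
      by (simp_all add: D_deformation_def linear_cmul[OF linear_jac[OF that]])
  qed
  have smooth_phi: "smooth_in_chart c W (\<lambda>p. phi ?S c p u)" if "c \<in> A" for c u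
    using SD(4)[OF that] by (simp add: D_deformation_def)
  have "smooth_manifold X A" "DIM('e) = 2 * n + 1"
    using S unfolding almost_paracontact_metric_on_iff by blast+
  then show ?thesis
    unfolding almost_paracontact_metric_on_iff
    by (intro conjI ballI allI SD(1) space smooth_xi smooth_phi smooth_eta smooth_metric tensorial)
qed

text \<open>
  As \<open>\<eta> \<circ> \<phi> = 0\<close>, the deformation multiplies the fundamental form by the constant \<open>\<gamma>\<close>, while \<open>\<eta>\<close> becomes
  \<open>\<beta>\<eta>\<close>; so the factor in \<open>d\<Phi> = 2\<alpha> \<eta> \<and> \<Phi>\<close> is divided by \<open>\<beta>\<close>. The form \<open>\<beta>\<eta>\<close> is closed since
  \<open>d\<beta> \<and> \<eta> = 0\<close> and \<open>d\<eta> = 0\<close>.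
\<close>

lemma almost_paracosymplectic_on_D_deformation:
  assumes S: "almost_paracosymplectic_on X A n W \<alpha> S" and D: "D_admissible_on A W \<gamma> \<beta> S"
  shows "almost_paracosymplectic_on X A n W (\<lambda>p. \<alpha> p / \<beta> p) (D_deformation \<gamma> \<beta> S)"
proof -
  let ?S = "D_deformation \<gamma> \<beta> S"
  have P: "almost_paracontact_metric_on X A n W S" and \<alpha>: "c \<in> A \<Longrightarrow> smooth_in_chart c W \<alpha>" for c
    using S unfolding almost_paracosymplectic_on_def smooth_function_def by auto
  note SD = almost_paracontact_metric_onD[OF P]
  have \<beta>: "c \<in> A \<Longrightarrow> smooth_in_chart c W \<beta>" and \<beta>0: "p \<in> W \<Longrightarrow> \<beta> p \<noteq> 0" for c p
    using D unfolding D_admissible_on_def smooth_function_def by auto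
  have "smooth_in_chart c W (\<lambda>p. \<alpha> p / \<beta> p)" if c: "c \<in> A" for c
    unfolding divide_inverse
    by (intro smooth_in_chart_mult[OF SD(2)[OF c] SD(1)] smooth_in_chart_inverse[OF SD(2)[OF c] SD(1)]
        \<alpha> \<beta> \<beta>0 c)
  moreover have "d1 (eta ?S) c p u v = 0" if c: "c \<in> A" and p: "p \<in> fst c \<inter> W" for c p u v
  proof -
    have "chart_deriv c (\<lambda>q. \<beta> q * eta S c q w) p =
        (\<lambda>t. \<beta> p * chart_deriv c (\<lambda>q. eta S c q w) p t + d0 \<beta> c p t * eta S c p w)" for w
      using has_derivative_mult[OF smooth_in_chart_has_derivative[OF \<beta>[OF c] p]
          smooth_in_chart_has_derivative[OF SD(5)[OF c] p], of w] chart_inv_chart[OF SD(2)[OF c]] p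
      by (intro chart_deriv_eqI[OF SD(2)[OF c] SD(1) p]) (auto simp: d0_def comp_def)
    moreover have "d1 (eta S) c p u v = 0" "wedge11 (d0 \<beta>) (eta S) c p u v = 0"
      using S D c p unfolding almost_paracosymplectic_on_def D_admissible_on_def by auto
    ultimately show ?thesis
      by (simp add: D_deformation_def d1_def wedge11_def algebra_simps)
  qed
  moreover have "d2 (fundamental_form ?S) c p u v w =
      2 * (\<alpha> p / \<beta> p) * wedge12 (eta ?S) (fundamental_form ?S) c p u v w"
    if c: "c \<in> A" and p: "p \<in> fst c \<inter> W" for c p u v w
  proof -
    have \<Phi>: "fundamental_form ?S c q u v = \<gamma> * fundamental_form S c q u v"
      if "q \<in> fst c \<inter> W" for q u v
      using paracontact_space.eta_phi[OF paracontact_space_at[OF P c that]]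
      by (simp add: fundamental_form_def D_deformation_def)
    have "chart_deriv c (\<lambda>q. fundamental_form ?S c q u v) p =
        (\<lambda>t. \<gamma> * chart_deriv c (\<lambda>q. fundamental_form S c q u v) p t)" for u v
      by (rule chart_deriv_eqI[OF SD(2)[OF c] SD(1) p,
            where f = "\<lambda>q. \<gamma> * fundamental_form S c q u v"])
        (use has_derivative_mult_right[OF smooth_in_chart_has_derivative[OF
            smooth_fundamental_form[OF P c] p], of \<gamma>] \<Phi> in \<open>auto simp: comp_def\<close>)
    then have "d2 (fundamental_form ?S) c p u v w = \<gamma> * d2 (fundamental_form S) c p u v w"
      by (simp add: d2_def algebra_simps)
    also have "\<dots> = \<gamma> * (2 * \<alpha> p * wedge12 (eta S) (fundamental_form S) c p u v w)"
      using S c p unfolding almost_paracosymplectic_on_def by auto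
    also have "\<dots> = 2 * (\<alpha> p / \<beta> p) * wedge12 (eta ?S) (fundamental_form ?S) c p u v w"
    proof -
      have "eta ?S c p u = \<beta> p * eta S c p u" for u by (simp add: D_deformation_def)
      then have "wedge12 (eta ?S) (fundamental_form ?S) c p u v w =
          \<beta> p * (\<gamma> * wedge12 (eta S) (fundamental_form S) c p u v w)"
        unfolding wedge12_def \<Phi>[OF p] by (simp add: algebra_simps)
      then show ?thesis using \<beta>0 p by simp
    qed
    finally show ?thesis .
  qed
  ultimately show ?thesis
    using almost_paracontact_metric_on_D_deformation[OF P D]
    unfolding almost_paracosymplectic_on_def smooth_function_def by blast
qed

lemma almost_paracosymplectic_on_cong:
  assumes S: "almost_paracosymplectic_on X A n W \<alpha> S" and eq: "\<And>p. p \<in> W \<Longrightarrow> \<alpha> p = \<beta> p"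
  shows "almost_paracosymplectic_on X A n W \<beta> S"
proof -
  have P: "almost_paracontact_metric_on X A n W S"
    using S unfolding almost_paracosymplectic_on_def by simp
  note PD = almost_paracontact_metric_onD[OF P]
  have "smooth_in_chart c W \<beta>" if "c \<in> A" for c
    by (rule smooth_in_chart_cong[OF PD(2)[OF that] PD(1), of \<alpha>])
      (use S that eq in \<open>auto simp: almost_paracosymplectic_on_def smooth_function_def\<close>)
  then show ?thesis using S eq unfolding almost_paracosymplectic_on_def smooth_function_def by auto
qed

theorem theorem11:
  fixes X :: "'a topology"
    and A :: "('a, 'e::euclidean_space) chart set"
    and S :: "('a, 'e) apm_structure"
    and \<alpha> :: "'a \<Rightarrow> real"
    and \<gamma> :: real
    and n :: nat
  assumes "almost_paracosymplectic_on X A n (topspace X) \<alpha> S"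
    and "n \<ge> 2"
    and "\<gamma> > 0"
  shows "\<forall>p \<in> {p \<in> topspace X. \<alpha> p \<noteq> 0}.
           \<exists>W. openin X W \<and> p \<in> W \<and> W \<subseteq> {p \<in> topspace X. \<alpha> p \<noteq> 0} \<and>
               D_admissible_on A W \<gamma> \<alpha> S \<and>
               almost_para_kenmotsu_on X A n W (D_deformation \<gamma> \<alpha> S)"
proof
  fix p assume p: "p \<in> {p \<in> topspace X. \<alpha> p \<noteq> 0}"
  have P: "almost_paracontact_metric_on X A n (topspace X) S"
    and smooth: "c \<in> A \<Longrightarrow> smooth_in_chart c (topspace X) \<alpha>" for c
    using assms(1) unfolding almost_paracosymplectic_on_def smooth_function_def by auto
  have "(\<Union>c\<in>A. fst c) = topspace X"
    using P unfolding almost_paracontact_metric_on_def smooth_manifold_def smooth_atlas_def by simp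
  then obtain c where c: "c \<in> A" "p \<in> fst c" "fst c \<subseteq> topspace X" using p by blast
  define W where "W = {q \<in> fst c. \<alpha> q \<noteq> 0}"
  have W: "openin X W" "p \<in> W" "W \<subseteq> {p \<in> topspace X. \<alpha> p \<noteq> 0}"
    using openin_nonzero_in_chart[OF almost_paracontact_metric_onD(2)[OF P c(1)] smooth[OF c(1)]] c p
    by (auto simp: W_def)
  have SW: "almost_paracosymplectic_on X A n W \<alpha> S"
    using almost_paracosymplectic_on_subset[OF assms(1) W(1)] W(3) by blast
  have D: "D_admissible_on A W \<gamma> \<alpha> S"
    using assms(3) SW W(3) d_alpha_wedge_eta[OF SW assms(2)]
    unfolding D_admissible_on_def almost_paracosymplectic_on_def by auto
  have "almost_para_kenmotsu_on X A n W (D_deformation \<gamma> \<alpha> S)"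
    unfolding almost_para_kenmotsu_on_def
    by (rule almost_paracosymplectic_on_cong[OF almost_paracosymplectic_on_D_deformation[OF SW D]])
      (use W(3) in auto)
  with W D show "\<exists>W. openin X W \<and> p \<in> W \<and> W \<subseteq> {p \<in> topspace X. \<alpha> p \<noteq> 0} \<and>
      D_admissible_on A W \<gamma> \<alpha> S \<and> almost_para_kenmotsu_on X A n W (D_deformation \<gamma> \<alpha> S)"
    by blast
qed

end
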